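(* Let $\gamma$ be a simple open rectifiable arc in the plane $\mathbb{R}^2$ that is not a line segment. Then there exist two (distinct) parallel support lines $m$ and $n$ of $\gamma$ and points $u,v,w$ of $\gamma$ such that $u\neq w$, the points $u$ and $w$ lie on $m$, the point $v$ lies on $n$, and $v$ lies between $u$ and $w$ in the parametric ordering of the points of $\gamma$ (that is, writing $u=\gamma(t_u)$, $v=\gamma(t_v)$, $w=\gamma(t_w)$, the parameter $t_v$ lies strictly between $t_u$ and $t_w$).
   Context: A simple open arc is a one-to-one continuous rectifiable image of the interval $[0,1]$ in the plane, with $\gamma(0)\neq\gamma(1)$; the map $\gamma$ and its range are denoted by the same letter. A support line of $\gamma$ is a line that meets $\gamma$ and has all of $\gamma$ in one of its two closed half-planes (equivalently, a support line of the convex hull of $\gamma$). *)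

theory Defs
  imports "HOL-Analysis.Analysis"
begin

definition inscribed_polygon_lengths :: "(real \<Rightarrow> 'a::metric_space) \<Rightarrow> real set" where
  "inscribed_polygon_lengths g =
     {(\<Sum>i<n. dist (g (t i)) (g (t (Suc i)))) | (t :: nat \<Rightarrow> real) (n :: nat).
        t 0 = 0 \<and> t n = 1 \<and> (\<forall>i<n. t i < t (Suc i))}"

definition rectifiable :: "(real \<Rightarrow> 'a::metric_space) \<Rightarrow> bool" where
  "rectifiable g \<longleftrightarrow> path g \<and> bdd_above (inscribed_polygon_lengths g)"

(* In the plane the hyperplanes {x. a \<bullet> x = b} with a nonzero are exactly the lines, and the two
   inequalities describe the two closed half-planes bounded by the line. *)
definition support_line :: "(real^2) set \<Rightarrow> (real^2) set \<Rightarrow> bool" where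
  "support_line S m \<longleftrightarrow>
     m \<inter> S \<noteq> {} \<and>
     (\<exists>a b. a \<noteq> 0 \<and> m = {x. a \<bullet> x = b} \<and>
        (S \<subseteq> {x. a \<bullet> x \<le> b} \<or> S \<subseteq> {x. a \<bullet> x \<ge> b}))"

end

theory Submission
  imports Defs
begin

text \<open>For a unit vector \<open>e\<close> compare the parameters where \<open>e \<bullet> \<gamma>\<close> is maximal with those where it is
  minimal. The directions in which some maximum precedes some minimum form a closed subset \<open>P\<close> of
  the sphere, the directions in which some maximum follows some minimum form \<open>- P\<close>, and together
  they cover the sphere. Since the sphere is connected, some direction lies in both sets, and
  there the parameters of the extrema interlace.\<close>

lemma interlaced_extrema:
  fixes \<gamma> :: "real \<Rightarrow> 'a::euclidean_space"
  assumes dim: "2 \<le> DIM('a)" and "path \<gamma>"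
    and nonconst: "\<And>e c. norm e = 1 \<Longrightarrow> \<not> path_image \<gamma> \<subseteq> {x. e \<bullet> x = c}"
  obtains e r s t where "norm e = 1" "0 \<le> r" "r < s" "s < t" "t \<le> 1" "e \<bullet> \<gamma> r = e \<bullet> \<gamma> t"
    "e \<bullet> \<gamma> s < e \<bullet> \<gamma> t" "path_image \<gamma> \<subseteq> {x. e \<bullet> \<gamma> s \<le> e \<bullet> x \<and> e \<bullet> x \<le> e \<bullet> \<gamma> t}"
proof -
  define ext where "ext e a b \<longleftrightarrow> (\<forall>x\<in>{0..1}. e \<bullet> \<gamma> x \<le> e \<bullet> \<gamma> a \<and> e \<bullet> \<gamma> b \<le> e \<bullet> \<gamma> x)" for e a b
  define D where "D = sphere (0::'a) 1 \<times> {0..1::real} \<times> {0..1::real}"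
  \<comment> \<open>The weak inequality between the parameters keeps \<open>C\<close> closed. It
    costs nothing, since \<open>distinct\<close> will rule out equality.\<close>
  define C where "C = {(e, a, b) \<in> D. a \<le> b \<and> ext e a b}"
  have cont: "continuous_on {0..1} \<gamma>"
    using \<open>path \<gamma>\<close> by (simp add: path_def)
  have "compact D"
    unfolding D_def by (intro compact_Times) auto
  have cont_D [continuous_intros]:
    "continuous_on D (\<lambda>z. \<gamma> (fst (snd z)))" "continuous_on D (\<lambda>z. \<gamma> (snd (snd z)))"
    by (rule continuous_on_compose2[OF cont]; force simp: D_def intro!: continuous_intros)+
  \<comment> \<open>Extremality is split into one weak inequality between continuous functions on
    the compact set \<open>D\<close> for each test parameter \<open>x\<close>, so \<open>C\<close>
    is an intersection of closed sets.\<close>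
  have "C = {z \<in> D. fst (snd z) \<le> snd (snd z)} \<inter>
      (\<Inter>x\<in>{0..1}. {z \<in> D. fst z \<bullet> \<gamma> x \<le> fst z \<bullet> \<gamma> (fst (snd z))} \<inter>
                   {z \<in> D. fst z \<bullet> \<gamma> (snd (snd z)) \<le> fst z \<bullet> \<gamma> x})" (is "_ = ?C")
    unfolding C_def ext_def by fastforce
  moreover have "closed ?C"
    using \<open>compact D\<close>
    by (intro closed_Int closed_INT ballI continuous_on_closed_Collect_le continuous_intros
         compact_imp_closed)
  moreover have "C = D \<inter> C"
    unfolding C_def by blast
  ultimately have "compact C"
    using compact_Int_closed[OF \<open>compact D\<close>] by metis
  \<comment> \<open>Projecting the compact set \<open>C\<close> to its directions gives a compact,
    hence closed, set.\<close>
  define P where "P = fst ` C"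
  have P_iff: "e \<in> P \<longleftrightarrow> norm e = 1 \<and> (\<exists>a\<in>{0..1}. \<exists>b\<in>{0..1}. a \<le> b \<and> ext e a b)" for e
  proof -
    have "e \<in> P \<longleftrightarrow> (\<exists>a b. (e, a, b) \<in> C)"
      unfolding P_def by force
    then show ?thesis
      unfolding C_def D_def by (simp del: atLeastAtMost_iff) blast
  qed
  \<comment> \<open>Reversing the direction exchanges maxima and minima, so
    \<open>- e \<in> P\<close> says that for \<open>e\<close> some minimum comes no later than some
    maximum.\<close>
  have ext_minus: "ext (- e) a b \<longleftrightarrow> ext e b a" for e a b
    unfolding ext_def by auto
  \<comment> \<open>If the two extreme values agreed, the path would lie in a hyperplane orthogonal
    to \<open>e\<close>, against \<open>nonconst\<close>.\<close>
  have distinct: "e \<bullet> \<gamma> b < e \<bullet> \<gamma> a" if "norm e = 1" "ext e a b" "a \<in> {0..1}" "b \<in> {0..1}" for e a b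
  proof (rule ccontr)
    assume "\<not> e \<bullet> \<gamma> b < e \<bullet> \<gamma> a"
    then have "path_image \<gamma> \<subseteq> {x. e \<bullet> x = e \<bullet> \<gamma> a}"
      using that unfolding path_image_def ext_def by fastforce
    then show False
      using nonconst \<open>norm e = 1\<close> by blast
  qed
  have "closed P"
    unfolding P_def
    by (intro compact_imp_closed compact_continuous_image \<open>compact C\<close> continuous_intros)
  then have "closed (uminus ` P)"
    by (rule closed_negations)
  have cover: "sphere 0 1 \<subseteq> P \<union> uminus ` P"
  proof
    fix e :: 'a
    assume "e \<in> sphere 0 1"
    have "continuous_on {0..1} (\<lambda>x. e \<bullet> \<gamma> x)"
      by (intro continuous_intros cont)
    then obtain a b where ab: "a \<in> {0..1}" "b \<in> {0..1}"
      and "\<forall>x\<in>{0..1}. e \<bullet> \<gamma> x \<le> e \<bullet> \<gamma> a" "\<forall>x\<in>{0..1}. e \<bullet> \<gamma> b \<le> e \<bullet> \<gamma> x"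
      using continuous_attains_sup[OF compact_Icc, of 0 1 "\<lambda>x. e \<bullet> \<gamma> x"]
        continuous_attains_inf[OF compact_Icc, of 0 1 "\<lambda>x. e \<bullet> \<gamma> x"]
      by (simp del: atLeastAtMost_iff) blast
    then have "ext e a b"
      unfolding ext_def by blast
    moreover have "norm e = 1"
      using \<open>e \<in> sphere 0 1\<close> by simp
    ultimately have "e \<in> P \<or> - e \<in> P"
      using ab linear[of a b] unfolding P_iff ext_minus norm_minus_cancel by blast
    then show "e \<in> P \<union> uminus ` P"
      by (metis UnI1 UnI2 image_eqI minus_minus)
  qed
  obtain e0 :: 'a where "e0 \<in> sphere 0 1"
    using vector_choose_size[of 1] by auto
  \<comment> \<open>If they were disjoint, connectedness would make one of the two closed sets miss
    the sphere. By antipodal symmetry the other would miss it too, yet they cover the point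
    \<open>e0\<close>.\<close>
  have "P \<inter> uminus ` P \<noteq> {}"
  proof
    assume "P \<inter> uminus ` P = {}"
    then have "P \<inter> sphere 0 1 = {} \<or> uminus ` P \<inter> sphere 0 1 = {}"
      using connected_closedD[OF connected_sphere[OF dim] _ cover \<open>closed P\<close> \<open>closed (uminus ` P)\<close>]
      by blast
    moreover have "uminus ` P \<inter> sphere 0 1 = uminus ` (P \<inter> sphere 0 1)"
      by auto
    ultimately show False
      using cover \<open>e0 \<in> sphere 0 1\<close> by blast
  qed
  then obtain e where "e \<in> P" "- e \<in> P"
    by auto
  then obtain a b a' b' where e: "norm e = 1" and ab: "a \<in> {0..1}" "b \<in> {0..1}" "a \<le> b" "ext e a b"
    and ab': "a' \<in> {0..1}" "b' \<in> {0..1}" "b' \<le> a'" "ext e a' b'"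
    unfolding P_iff ext_minus by blast
  note result = that
  \<comment> \<open>Weakly ordered parameters suffice: the values at \<open>r\<close> and
    \<open>t\<close> exceed the value at \<open>s\<close>, so the parameters differ.\<close>
  have interlaced: thesis
    if "norm f = 1" "r \<in> {0..1}" "s \<in> {0..1}" "t \<in> {0..1}" "r \<le> s" "s \<le> t" "ext f r s" "ext f t s"
    for f r s t
  proof -
    have "f \<bullet> \<gamma> r = f \<bullet> \<gamma> t"
      using that unfolding ext_def by (meson order_antisym)
    moreover have "f \<bullet> \<gamma> s < f \<bullet> \<gamma> t"
      using distinct that by blast
    moreover from calculation have "r < s" "s < t"
      using that by (auto simp: order.strict_iff_order)
    ultimately show thesis
      using that by (intro result[of f r s t]) (auto simp: ext_def path_image_def)
  qed
  show thesis
  \<comment> \<open>Either \<open>a \<le> b \<le> a'\<close> is a pattern maximum, minimum, maximum,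
    or \<open>b' \<le> a' < b\<close> is minimum, maximum, minimum, which becomes the first pattern
    for \<open>- e\<close>.\<close>
  proof (cases "b \<le> a'")
    case True
    moreover have "ext e a' b"
      using ab ab' unfolding ext_def by blast
    ultimately show thesis
      using interlaced[of e a b a'] e ab ab' by blast
  next
    case False
    moreover have "ext e a' b"
      using ab ab' unfolding ext_def by blast
    ultimately show thesis
      using interlaced[of "- e" b' a' b] e ab ab' unfolding ext_minus by simp
  qed
qed

text \<open>In dimension two the hyperplane is a line; a connected subset of a line is convex, and a
  nonempty compact convex one is a segment. This turns the hypothesis of not being a segment into
  \<open>nonconst\<close>.\<close>

lemma path_image_in_line_segment:
  fixes \<gamma> :: "real \<Rightarrow> 'a::euclidean_space"
  assumes "DIM('a) = 2" "path \<gamma>" "e \<noteq> 0" "path_image \<gamma> \<subseteq> {x. e \<bullet> x = c}"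
  obtains a b where "path_image \<gamma> = closed_segment a b"
proof -
  have "collinear {x. e \<bullet> x = c}"
    using assms by (simp add: collinear_aff_dim)
  then have col: "collinear (path_image \<gamma>)"
    using assms(4) collinear_subset by blast
  then have "convex (path_image \<gamma>)"
    using assms(2) by (simp add: convex_connected_collinear connected_path_image)
  then show thesis
    using that compact_convex_collinear_segment[of "path_image \<gamma>"] col assms(2)
    by (auto simp: compact_path_image)
qed

lemma affine_parallel_hyperplanes:
  fixes e :: "'a::euclidean_space"
  assumes "norm e = 1"
  shows "affine_parallel {x. e \<bullet> x = c} {x. e \<bullet> x = d}"
proof -
  have ee: "e \<bullet> e = 1"
    using assms by (simp add: dot_square_norm)
  \<comment> \<open>Moving along the unit normal \<open>e\<close> by \<open>d - c\<close> changes
    the inner product with \<open>e\<close> by exactly \<open>d - c\<close>.\<close>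
  have "x \<in> (+) ((d - c) *\<^sub>R e) ` {x. e \<bullet> x = c}" if "e \<bullet> x = d" for x
    using that ee by (intro image_eqI[of _ _ "x - (d - c) *\<^sub>R e"]) (auto simp: inner_diff_right)
  then show ?thesis
    unfolding affine_parallel_def using ee
    by (intro exI[of _ "(d - c) *\<^sub>R e"]) (auto simp: inner_add_right)
qed

theorem theorem1:
  fixes \<gamma> :: "real \<Rightarrow> real^2"
  assumes "arc \<gamma>"
    and "rectifiable \<gamma>"
    and "\<nexists>a b. path_image \<gamma> = closed_segment a b"
  shows "\<exists>m n u v w tu tv tw.
    support_line (path_image \<gamma>) m \<and> support_line (path_image \<gamma>) n \<and>
    affine_parallel m n \<and> m \<noteq> n \<and>
    tu \<in> {0..1} \<and> tv \<in> {0..1} \<and> tw \<in> {0..1} \<and>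
    u = \<gamma> tu \<and> v = \<gamma> tv \<and> w = \<gamma> tw \<and>
    u \<noteq> w \<and> u \<in> m \<and> w \<in> m \<and> v \<in> n \<and>
    (tu < tv \<and> tv < tw \<or> tw < tv \<and> tv < tu)"
proof -
  have "path \<gamma>" and inj: "inj_on \<gamma> {0..1}"
    using \<open>arc \<gamma>\<close> by (auto simp: arc_def)
  have nonconst: "\<not> path_image \<gamma> \<subseteq> {x. e \<bullet> x = c}" if "norm e = 1" for e c
    using path_image_in_line_segment[of \<gamma> e c] \<open>path \<gamma>\<close> assms(3) that by force
  obtain e r s t where e: "norm e = 1" and order: "0 \<le> r" "r < s" "s < t" "t \<le> 1"
    and "e \<bullet> \<gamma> r = e \<bullet> \<gamma> t" and less: "e \<bullet> \<gamma> s < e \<bullet> \<gamma> t"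
    and strip: "path_image \<gamma> \<subseteq> {x. e \<bullet> \<gamma> s \<le> e \<bullet> x \<and> e \<bullet> x \<le> e \<bullet> \<gamma> t}"
    using interlaced_extrema[OF _ \<open>path \<gamma>\<close> nonconst] by simp blast
  have "\<gamma> s \<in> path_image \<gamma>" "\<gamma> t \<in> path_image \<gamma>"
    using order by (auto simp: path_image_def)
  moreover have "e \<noteq> 0"
    using e by auto
  ultimately have "support_line (path_image \<gamma>) {x. e \<bullet> x = e \<bullet> \<gamma> t}"
    and "support_line (path_image \<gamma>) {x. e \<bullet> x = e \<bullet> \<gamma> s}"
    unfolding support_line_def using strip by blast+
  \<comment> \<open>Both points lie on the same support line, so it is injectivity of the arc that
    separates them.\<close>
  moreover have "\<gamma> r \<noteq> \<gamma> t"
    using inj order by (auto dest: inj_onD)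
  ultimately show ?thesis
    using order less e \<open>e \<bullet> \<gamma> r = e \<bullet> \<gamma> t\<close>
    \<comment> \<open>The line of maxima serves as \<open>m\<close> and the line of minima as
      \<open>n\<close>; \<open>less\<close> makes them distinct.\<close>
    by (intro exI[of _ "{x. e \<bullet> x = e \<bullet> \<gamma> t}"] exI[of _ "{x. e \<bullet> x = e \<bullet> \<gamma> s}"]
        exI[of _ "\<gamma> r"] exI[of _ "\<gamma> s"] exI[of _ "\<gamma> t"] exI[of _ r] exI[of _ s] exI[of _ t])
      (auto simp: affine_parallel_hyperplanes)
qed

end
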